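(* Let $m$ be an odd positive integer, $q=2^m$, and $\gamma\in\mathbb{F}_q$. Let $f(X)=X+\gamma\,\mathrm{Tr}_{q}^{q^2}\left(X+X^2+X^{2q-1}\right)\in\mathbb{F}_{q^2}[X]$. Then $f(X)$ is a permutation polynomial over $\mathbb{F}_{q^2}$ if and only if $\gamma\in\{0,1\}$.
   Context: For a prime power $q$, $\mathbb{F}_q$ is the finite field with $q$ elements. $\mathrm{Tr}_{q}^{q^2}(x)=x+x^q$ is the relative trace from $\mathbb{F}_{q^2}$ to $\mathbb{F}_q$. A polynomial $f\in\mathbb{F}_{Q}[X]$ is a permutation polynomial over $\mathbb{F}_{Q}$ if the map $c\mapsto f(c)$ is a bijection of $\mathbb{F}_{Q}$ to itself. *)

theory Defs
  imports "HOL-Algebra.Algebraic_Closure_Type" "HOL-Library.Cardinality"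
begin

(* The relative trace from a field with q^2 elements to its subfield with q elements.
   It is stated for arbitrary commutative rings so that it also applies to elements of
   the polynomial ring; there it is compatible with evaluation (poly_rel_trace). *)
definition rel_trace :: "nat \<Rightarrow> 'a::comm_ring_1 \<Rightarrow> 'a" where
  "rel_trace q x = x + x ^ q"

lemma poly_rel_trace: "poly (rel_trace q p) c = rel_trace q (poly p c)"
  by (simp add: rel_trace_def)

definition permutation_polynomial :: "'a::{field,finite} poly \<Rightarrow> bool" where
  "permutation_polynomial f \<longleftrightarrow> bij (poly f)"

end

theory Submission
  imports Defs
begin

text \<open>
  With $T = x + x^q$ and $N = x \cdot x^q$ one has $f(x) = x + \gamma (T^2 + T^3/N)$, so two points with
  the same image differ by some $t \in F$ and have the same $T$. Normalising $n = N/T^2$ and $s = t/T$,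
  a collision means $n (n + s + s^2) = \gamma (1 + s)$ with $s \in F \setminus \{0\}$, where $n$
  runs through the elements of $F$ that are not of the form $s^2 + s$, i.e. those
  outside the additive subgroup $K$ of index 2 in $F$. If $\gamma = 1$, solving this
  quadratic equation for $s$ would put $n$ into $K$. If $\gamma \notin \{0, 1\}$, a suitable $n$ exists:
  $\gamma$ itself if $\gamma \notin K$; otherwise solvability amounts to finding
  $u \notin K$ with $a/u \notin K$ for a fixed nonzero $a$, which counting provides, as
  $F \setminus K$ has more elements than $K \setminus \{0\}$.
\<close>

text \<open>Multiplication by \<open>x \<noteq> 0\<close> permutes the nonzero elements; comparing
  products gives \<open>x ^ (card F - 1) = 1\<close>. Allowing a subset serves both the whole field
  and its subfield.\<close>

lemma power_card_eq_self:
  fixes F :: "'a::idom set"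
  assumes "finite F" "0 \<in> F" "\<And>x y. x \<in> F \<Longrightarrow> y \<in> F \<Longrightarrow> x * y \<in> F" "x \<in> F"
  shows "x ^ card F = x"
proof (cases "x = 0")
  case True
  then show ?thesis using assms by (auto simp: card_gt_0_iff)
next
  case False
  let ?G = "F - {0}"
  have fin: "finite ?G" using assms(1) by simp
  have inj: "inj_on ((*) x) ?G" using False by (auto intro: inj_onI)
  have "(*) x ` ?G \<subseteq> ?G" using False assms by auto
  then have img: "(*) x ` ?G = ?G" using inj fin by (simp add: endo_inj_surj)
  have "\<Prod>?G = (\<Prod>y\<in>?G. x * y)"
    using prod.reindex[OF inj, of id] by (simp add: img)
  also have "\<dots> = x ^ card ?G * \<Prod>?G" by (simp add: prod.distrib)
  finally have "x ^ card ?G = 1" using fin by simp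
  moreover have "card F = Suc (card ?G)"
    using assms(1,2) by (rule card.remove)
  ultimately show ?thesis by simp
qed

text \<open>Translation by 1 permutes the ring, so adding 1 to every summand leaves the total sum
  unchanged.\<close>

lemma of_nat_CARD_eq_0: "of_nat CARD('a::{comm_ring_1,finite}) = (0 :: 'a)"
proof -
  have "(\<Sum>x\<in>UNIV. x + 1) = \<Sum>(UNIV :: 'a set)"
    by (rule sum.reindex_bij_witness[where i = "\<lambda>x. x - 1" and j = "\<lambda>x. x + 1"]) auto
  then show ?thesis by (simp add: sum.distrib)
qed

section \<open>Arithmetic in characteristic 2 and the fixed field \<open>F\<close> of the q-power
  map\<close>

locale quadratic_extension_char2 =
  fixes m q :: nat and F :: "'a::{field,finite} set"
  assumes q_eq: "q = 2 ^ m" and m_pos: "m > 0" and card_UNIV: "CARD('a) = q ^ 2"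
    and F_eq: "F = {x. x ^ q = x}" and card_F: "card F = q"
begin

lemma two_eq_0: "(2 :: 'a) = 0"
proof -
  have "of_nat ((2 ^ m) ^ 2) = (0 :: 'a)"
    using of_nat_CARD_eq_0[where 'a = 'a] by (simp add: card_UNIV q_eq)
  then show ?thesis by simp
qed

lemma add_self [simp]: "x + x = (0 :: 'a)"
  using two_eq_0 by (metis mult_2 mult_zero_left)

lemma add_self_left [simp]: "x + (x + y) = (y :: 'a)"
  by (simp flip: add.assoc)

lemma minus_eq [simp]: "- x = (x :: 'a)"
  by (simp add: minus_unique)

lemma diff_eq [simp]: "x - y = (x + y :: 'a)"
  using add_uminus_conv_diff[of x y] by simp

lemma add_eq_0 [simp]: "x + y = 0 \<longleftrightarrow> x = (y :: 'a)"
  using eq_iff_diff_eq_0[of x y] by simp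

lemma square_add: "(x + y) ^ 2 = x ^ 2 + (y :: 'a) ^ 2"
  by (simp add: power2_sum two_eq_0)

lemma power_q_add: "(x + y) ^ q = x ^ q + (y :: 'a) ^ q"
proof -
  have "(x + y) ^ (2 ^ k) = x ^ (2 ^ k) + y ^ (2 ^ k)" for k
    by (induction k) (simp_all add: power_mult power_Suc2 square_add del: power_Suc)
  then show ?thesis by (simp add: q_eq)
qed

lemma power_q_power_q [simp]: "((x :: 'a) ^ q) ^ q = x"
  using power_card_eq_self[of "UNIV :: 'a set" x]
  by (simp add: card_UNIV power2_eq_square power_mult)

lemma q_gt_1: "q > 1"
  using m_pos unfolding q_eq by (intro one_less_power) simp_all

lemma zero_power_q [simp]: "(0 :: 'a) ^ q = 0"
  using q_gt_1 by (simp add: power_0_left)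

lemma F_closed [simp, intro]:
  "0 \<in> F" "1 \<in> F" "x \<in> F \<Longrightarrow> y \<in> F \<Longrightarrow> x + y \<in> F" "x \<in> F \<Longrightarrow> y \<in> F \<Longrightarrow> x * y \<in> F"
  "x \<in> F \<Longrightarrow> y \<in> F \<Longrightarrow> x / y \<in> F" "x \<in> F \<Longrightarrow> x ^ k \<in> F"
proof -
  have "(x ^ k) ^ q = (x ^ q) ^ k" by (simp add: mult.commute flip: power_mult)
  then show "x \<in> F \<Longrightarrow> x ^ k \<in> F" by (simp add: F_eq)
qed (use q_gt_1 in \<open>simp_all add: F_eq power_q_add power_mult_distrib power_divide\<close>)

lemma trace_norm_in_F [simp]: "x + x ^ q \<in> F" "x * x ^ q \<in> F"
  by (auto simp: F_eq power_q_add power_mult_distrib add.commute mult.commute)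

lemma sqrt_in_F:
  assumes "x \<in> F" obtains r where "r \<in> F" "r ^ 2 = x"
proof
  show "x ^ (2 ^ (m - 1)) \<in> F" using assms by simp
  have "2 ^ (m - 1) * 2 = q" using m_pos by (simp add: q_eq flip: power_Suc2)
  then show "(x ^ (2 ^ (m - 1))) ^ 2 = x" using assms by (simp add: F_eq flip: power_mult)
qed

section \<open>The Artin-Schreier subgroup \<open>K\<close> (the elements of \<open>F\<close> of
  absolute trace 0)\<close>

definition K :: "'a set" where "K = (\<lambda>s. s ^ 2 + s) ` F"

lemma K_subset_F: "K \<subseteq> F"
  by (auto simp: K_def)

lemma K_I [intro]: "s \<in> F \<Longrightarrow> s ^ 2 + s \<in> K"
  by (simp add: K_def)

lemma zero_in_K [simp]: "0 \<in> K"
  using K_I[of 0] by simp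

lemma K_add: "a \<in> K \<Longrightarrow> b \<in> K \<Longrightarrow> a + b \<in> K"
proof -
  assume "a \<in> K" "b \<in> K"
  then obtain s t where "s \<in> F" "t \<in> F" "a = s ^ 2 + s" "b = t ^ 2 + t" by (auto simp: K_def)
  then show ?thesis using K_I[of "s + t"] by (simp add: square_add algebra_simps)
qed

lemma artin_schreier_eq_iff: "x ^ 2 + x = y ^ 2 + (y :: 'a) \<longleftrightarrow> x = y \<or> x = y + 1"
proof -
  have "x ^ 2 + x = y ^ 2 + y \<longleftrightarrow> (x + y) * (x + y + 1) = 0"
    unfolding add_eq_0[of "x ^ 2 + x", symmetric]
    by (simp add: algebra_simps power2_eq_square del: add_eq_0)
  also have "\<dots> \<longleftrightarrow> x = y \<or> x = y + 1"
    unfolding mult_eq_0_iff by (simp add: add.assoc)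
  finally show ?thesis .
qed

text \<open>The fibres of \<open>s ^ 2 + s\<close> on \<open>F\<close> are the pairs
  \<open>{s, s + 1}\<close>, so \<open>F\<close> is the disjoint union of the image of a section
  \<open>h\<close> and its shift by 1.\<close>

lemma card_F_eq_twice_card_K: "card F = 2 * card K"
proof -
  define h where "h = (\<lambda>k. SOME s. s \<in> F \<and> s ^ 2 + s = k)"
  have h: "h k \<in> F" "h k ^ 2 + h k = k" if "k \<in> K" for k
  proof -
    have "\<exists>s. s \<in> F \<and> s ^ 2 + s = k" using that by (auto simp: K_def)
    from someI_ex[OF this] show "h k \<in> F" "h k ^ 2 + h k = k" by (simp_all add: h_def)
  qed
  have "F = h ` K \<union> (\<lambda>k. h k + 1) ` K"
  proof
    show "h ` K \<union> (\<lambda>k. h k + 1) ` K \<subseteq> F" using h by auto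
    show "F \<subseteq> h ` K \<union> (\<lambda>k. h k + 1) ` K"
    proof
      fix s assume "s \<in> F"
      then have *: "s ^ 2 + s \<in> K" by blast
      with h(2)[OF *] have "s = h (s ^ 2 + s) \<or> s = h (s ^ 2 + s) + 1"
        using artin_schreier_eq_iff[of s "h (s ^ 2 + s)"] by simp
      with * show "s \<in> h ` K \<union> (\<lambda>k. h k + 1) ` K" by blast
    qed
  qed
  moreover have "h ` K \<inter> (\<lambda>k. h k + 1) ` K = {}"
  proof -
    have False if "k \<in> K" "l \<in> K" "h k = h l + 1" for k l
    proof -
      have "h k ^ 2 + h k = h l ^ 2 + h l" using that(3) artin_schreier_eq_iff by blast
      with that h(2) have "k = l" by metis
      with that(3) show False by simp
    qed
    then show ?thesis by blast
  qed
  moreover have "inj_on h K" "inj_on (\<lambda>k. h k + 1) K"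
    using h(2) by (auto intro!: inj_onI) metis+
  moreover have "finite K" by (rule finite)
  ultimately show ?thesis
    using card_Un_disjoint[of "h ` K" "(\<lambda>k. h k + 1) ` K"] by (simp add: card_image)
qed

lemma card_F_minus_K: "card (F - K) = card K"
  using card_F_eq_twice_card_K K_subset_F by (simp add: card_Diff_subset finite_subset)

text \<open>The coset \<open>a + K\<close> avoids \<open>K\<close> and has the size of
  \<open>F - K\<close>, hence fills it and contains \<open>b\<close>.\<close>

lemma sum_nonmembers_in_K:
  assumes "a \<in> F - K" "b \<in> F - K" shows "a + b \<in> K"
proof -
  have "(+) a ` K \<subseteq> F - K"
  proof clarsimp
    fix k assume "k \<in> K"
    then show "a + k \<in> F \<and> a + k \<notin> K"
      using assms(1) K_subset_F K_add[of "a + k" k] by (auto simp: add.assoc)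
  qed
  moreover have "card ((+) a ` K) = card (F - K)"
    by (simp add: card_F_minus_K card_image)
  ultimately have "(+) a ` K = F - K" by (simp add: card_subset_eq)
  with assms(2) obtain k where "k \<in> K" "b = a + k" by blast
  then show ?thesis by simp
qed

lemma quotient_pair_outside_K:
  assumes "a \<in> F" "a \<noteq> 0"
  obtains u where "u \<in> F - K" "a / u \<in> F - K"
proof -
  have "\<exists>u \<in> F - K. a / u \<notin> K"
  proof (rule ccontr)
    assume *: "\<not> ?thesis"
    have "inj_on (\<lambda>u. a / u) (F - K)" using assms by (auto intro!: inj_onI simp: field_simps)
    \<comment> \<open>Since \<open>0 \<in> K\<close>, every \<open>u\<close> here is nonzero, so
      \<open>a / u\<close> is nonzero too; this missing 0 makes the count strict.\<close>
    moreover have "(\<lambda>u. a / u) ` (F - K) \<subseteq> K - {0}" using * assms zero_in_K by auto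
    ultimately have "card (F - K) \<le> card (K - {0})" by (rule card_inj_on_le) simp
    moreover have "card (K - {0}) < card K" by (rule card_Diff1_less) simp_all
    ultimately show False by (simp add: card_F_minus_K)
  qed
  with that assms show thesis by blast
qed

section \<open>Elements of relative trace 1 with prescribed norm\<close>

lemma ex_trace_1: obtains w :: 'a where "w ^ q = w + 1"
proof -
  have "card F < CARD('a)"
    using q_gt_1 by (simp add: card_F card_UNIV power2_eq_square)
  then obtain v where v: "v \<notin> F" by (metis UNIV_eq_I less_irrefl)
  define t where "t = v + v ^ q"
  have t: "t \<in> F" "t \<noteq> 0" using v by (auto simp: t_def F_eq power_q_add add.commute)
  \<comment> \<open>Dividing by the trace \<open>t\<close>, which lies in \<open>F\<close>,
    normalises the trace to 1.\<close>
  then have "(v / t) ^ q = v / t + 1"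
    by (simp add: power_divide F_eq divide_simps) (simp add: t_def add_ac)
  then show thesis by (rule that)
qed

text \<open>For any \<open>w\<close> of trace 1, \<open>w ^ 2 + w\<close> is its norm and lies in
  \<open>F - K\<close>, because \<open>w\<close> and \<open>w + 1\<close> are outside
  \<open>F\<close>. It differs from \<open>n\<close> by some \<open>s ^ 2 + s\<close> with
  \<open>s \<in> F\<close>, so \<open>w + s\<close> is the desired root.\<close>

lemma artin_schreier_root:
  assumes "n \<in> F - K" obtains w where "w ^ 2 + w = n" "w ^ q = w + 1"
proof -
  obtain w :: 'a where w: "w ^ q = w + 1" by (rule ex_trace_1)
  have eq: "w ^ 2 + w = w * w ^ q" unfolding w by (simp add: power2_eq_square distrib_left)
  have "w \<notin> F" using w by (auto simp: F_eq)
  have "w ^ 2 + w \<notin> K"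
  proof
    assume "w ^ 2 + w \<in> K"
    then obtain s where "s \<in> F" "w ^ 2 + w = s ^ 2 + s" by (auto simp: K_def)
    then show False using \<open>w \<notin> F\<close> by (auto simp: artin_schreier_eq_iff)
  qed
  then have "n + (w ^ 2 + w) \<in> K"
    using assms by (intro sum_nonmembers_in_K) (auto simp: eq)
  then obtain s where s: "s \<in> F" "n + (w ^ 2 + w) = s ^ 2 + s" by (auto simp: K_def)
  show thesis
  proof
    have "n = (n + (w ^ 2 + w)) + (w ^ 2 + w)" by (simp add: add.assoc)
    then show "(w + s) ^ 2 + (w + s) = n" by (simp only: s(2)) (simp add: square_add add_ac)
    show "(w + s) ^ q = w + s + 1" using s(1) by (simp add: power_q_add w F_eq add_ac)
  qed
qed

section \<open>The map in terms of trace and norm\<close>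

definition T :: "'a \<Rightarrow> 'a" where "T x = x + x ^ q"
definition N :: "'a \<Rightarrow> 'a" where "N x = x * x ^ q"
text \<open>For \<^term>\<open>x = 0\<close> the quotient is \<open>0 / 0 = 0\<close>, which is the correct value there.\<close>

definition f :: "'a \<Rightarrow> 'a \<Rightarrow> 'a" where "f \<gamma> x = x + \<gamma> * (T x ^ 2 + T x ^ 3 / N x)"

lemma T_in_F [simp]: "T x \<in> F" and N_in_F [simp]: "N x \<in> F"
  by (simp_all add: T_def N_def)

lemma T_add: "t \<in> F \<Longrightarrow> T (x + t) = T x"
  by (simp add: T_def F_eq power_q_add add_ac)

lemma N_add: "t \<in> F \<Longrightarrow> N (x + t) = N x + t * T x + t ^ 2"
  by (simp add: T_def N_def F_eq power_q_add algebra_simps power2_eq_square)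

lemma N_eq_0 [simp]: "N x = 0 \<longleftrightarrow> x = 0"
  using q_gt_1 by (simp add: N_def)

text \<open>The quotient is \<open>z ^ 2 + z\<close> for \<open>z = x / T x\<close>. If it were in
  \<open>K\<close>, then \<open>z\<close> and hence \<open>x\<close> would lie in \<open>F\<close>,
  where the trace vanishes.\<close>

lemma norm_over_square_trace_notin_K:
  assumes "T x \<noteq> 0" shows "N x / T x ^ 2 \<notin> K"
proof
  define z where "z = x / T x"
  have "x ^ q = x + T x" by (simp add: T_def)
  then have "N x / T x ^ 2 = z ^ 2 + z"
    using assms by (simp add: N_def z_def power_divide divide_simps) (simp add: algebra_simps power2_eq_square)
  moreover assume "N x / T x ^ 2 \<in> K"
  ultimately obtain s where s: "s \<in> F" "z ^ 2 + z = s ^ 2 + s" by (auto simp: K_def)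
  then have "z \<in> F" by (auto simp: artin_schreier_eq_iff)
  then have "z * T x \<in> F" by simp
  then have "x \<in> F" using assms by (simp add: z_def)
  then show False using assms by (simp add: T_def F_eq)
qed

section \<open>Injectivity for \<open>\<gamma> = 1\<close>\<close>

lemma inj_f_1: "inj (f 1)"
proof (rule injI, rule ccontr)
  fix x y assume eq: "f 1 x = f 1 y" and "x \<noteq> y"
  define t where "t = T x ^ 2 + T x ^ 3 / N x + (T y ^ 2 + T y ^ 3 / N y)"
  have tF: "t \<in> F" by (simp add: t_def)
  have y: "y = x + t"
  proof -
    have "x + y + t = f 1 x + f 1 y" by (simp add: f_def t_def add_ac)
    then have "x + y = t" using eq by simp
    then show ?thesis by (metis add_self_left)
  qed
  have "t \<noteq> 0" using y \<open>x \<noteq> y\<close> by auto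
  have Ty: "T y = T x" and Ny: "N y = N x + t * T x + t ^ 2"
    using tF by (simp_all add: y T_add N_add)
  have t_eq: "t = T x ^ 3 / N x + T x ^ 3 / N y"
    by (simp add: t_def Ty add_ac)
  then have T0: "T x \<noteq> 0" using \<open>t \<noteq> 0\<close> by auto
  then have "x \<noteq> 0" "y \<noteq> 0" using q_gt_1 Ty by (auto simp: T_def[of 0])
  then have N0: "N x \<noteq> 0" "N y \<noteq> 0" by simp_all
  define n s where "n = N x / T x ^ 2" and "s = t / T x"
  have [simp]: "n \<in> F" "s \<in> F" using tF by (simp_all add: n_def s_def)
  have nK: "n \<notin> K" using norm_over_square_trace_notin_K[OF T0] by (simp add: n_def)
  have s0: "s \<noteq> 0" using \<open>t \<noteq> 0\<close> T0 by (simp add: s_def)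
  \<comment> \<open>\<open>N x + N y\<close> equals \<open>t * (T x + t)\<close>, so one factor
    \<open>t\<close> cancels.\<close>
  have "t * N x * N y = T x ^ 3 * (N x + N y)"
    by (subst t_eq) (use N0 in \<open>simp add: field_simps\<close>)
  also have "\<dots> = t * (T x ^ 3 * (T x + t))"
    by (simp add: Ny algebra_simps power2_eq_square)
  finally have "N x * N y = T x ^ 3 * (T x + t)"
    using \<open>t \<noteq> 0\<close> by (simp add: mult.assoc)
  moreover have "N x = n * T x ^ 2" "t = s * T x" using T0 by (simp_all add: n_def s_def)
  ultimately have "T x ^ 4 * (n * (n + s + s ^ 2)) = T x ^ 4 * (1 + s)"
    unfolding Ny by (simp add: algebra_simps power2_eq_square power3_eq_cube power4_eq_xxxx)
  then have rel: "n * (n + s + s ^ 2) = 1 + s" using T0 by simp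
  show False
  proof (cases "n = 1")
    case True
    with rel s0 show False by (simp add: algebra_simps)
  next
    case False
    \<comment> \<open>This scaling turns \<open>n s^2 + (n + 1) s = (n + 1)^2\<close> into
      \<open>\<sigma>^2 + \<sigma> = n\<close>.\<close>
    define \<sigma> where "\<sigma> = n * s / (n + 1)"
    have "n * s ^ 2 + (n + 1) * s + (n + 1) ^ 2 = n * (n + s + s ^ 2) + (1 + s)"
      by (simp add: algebra_simps power2_eq_square del: add_eq_0)
    also have "\<dots> = 0" using rel by simp
    finally have "n * s ^ 2 + (n + 1) * s = (n + 1) ^ 2" by simp
    then have "n * (n * s ^ 2 + (n + 1) * s) / (n + 1) ^ 2 = n" using False by simp
    moreover have "\<sigma> ^ 2 + \<sigma> = n * (n * s ^ 2 + (n + 1) * s) / (n + 1) ^ 2"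
      using False unfolding \<sigma>_def power_divide
      by (simp add: divide_simps) (simp add: algebra_simps power2_eq_square)
    moreover have "\<sigma> \<in> F" by (simp add: \<sigma>_def)
    ultimately show False using nK K_I[of \<sigma>] by simp
  qed
qed

section \<open>Collisions for the remaining \<open>\<gamma>\<close>\<close>

lemma collision_parameters:
  assumes "\<gamma> \<in> F" "\<gamma> \<noteq> 0" "\<gamma> \<noteq> 1"
  obtains n s where "n \<in> F - K" "s \<in> F" "s \<noteq> 0" "n * (n + s + s ^ 2) = \<gamma> * (1 + s)"
proof -
  have "\<gamma> + 1 \<in> F" using assms by simp
  then obtain r where r: "r \<in> F" "r ^ 2 = \<gamma> + 1" by (rule sqrt_in_F)
  have \<gamma>: "\<gamma> = r ^ 2 + 1" using r(2) by (simp add: add.assoc)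
  have r0: "r \<noteq> 0" "r \<noteq> 1" using \<gamma> assms by auto
  show thesis
  proof (cases "\<gamma> \<in> K")
    case False
    \<comment> \<open>The choice is \<open>n = \<gamma>\<close> and \<open>s = r\<close>.\<close>
    have "\<gamma> * (\<gamma> + r + r ^ 2) = \<gamma> * (1 + r)" by (simp add: r(2) add_ac)
    with False assms r r0 that show thesis by blast
  next
    case True
    have "\<gamma> * r * (r + 1) \<in> F" "\<gamma> * r * (r + 1) \<noteq> 0" using assms r r0 by auto
    then obtain u where u: "u \<in> F - K" "\<gamma> * r * (r + 1) / u \<in> F - K"
      by (rule quotient_pair_outside_K)
    have u0: "u \<noteq> 0" using u by auto
    define n where "n = u + \<gamma>"
    \<comment> \<open>The equation for \<open>s\<close> is \<open>n s\<^sup>2 + u s + n\<^sup>2 + \<gamma> = 0\<close>; substituting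
      \<open>s = u \<sigma> / n\<close> turns it into \<open>\<sigma>\<^sup>2 + \<sigma> = n (n\<^sup>2 + \<gamma>) / u\<^sup>2\<close>.\<close>
    have nK: "n \<notin> K"
      using u True K_add[of n \<gamma>] by (auto simp: n_def add.assoc)
    have nF: "n \<in> F" using u assms by (simp add: n_def)
    have n0: "n \<noteq> 0" using nK by auto
    \<comment> \<open>The constant \<open>a = \<gamma> * r * (r + 1)\<close> is chosen for this
      identity: the last bracket and \<open>\<gamma>\<close> lie in \<open>K\<close>, and
      \<open>u + a / u\<close> is a sum of two nonmembers.\<close>
    have "n * (n ^ 2 + \<gamma>) / u ^ 2 = (u + \<gamma> * r * (r + 1) / u) + \<gamma> + ((\<gamma> * r / u) ^ 2 + \<gamma> * r / u)"
    proof -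
      have "n * (n ^ 2 + \<gamma>) = u ^ 3 + u * (\<gamma> * r * (r + 1)) + u ^ 2 * \<gamma> + ((\<gamma> * r) ^ 2 + u * (\<gamma> * r))"
        unfolding n_def \<gamma> by (simp add: algebra_simps power2_eq_square power3_eq_cube)
      then show ?thesis using u0
        by (simp add: divide_simps) (simp add: algebra_simps power2_eq_square power3_eq_cube)
    qed
    also have "\<dots> \<in> K"
      using u True assms r by (intro K_add K_I sum_nonmembers_in_K) auto
    finally obtain \<sigma> where \<sigma>: "\<sigma> \<in> F" "\<sigma> ^ 2 + \<sigma> = n * (n ^ 2 + \<gamma>) / u ^ 2"
      by (auto simp: K_def)
    define s where "s = u * \<sigma> / n"
    have "n * (n * s ^ 2 + u * s) = u ^ 2 * (\<sigma> ^ 2 + \<sigma>)"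
      using n0 by (simp add: s_def field_simps power2_eq_square)
    also have "\<dots> = n * (n ^ 2 + \<gamma>)" using u0 by (simp add: \<sigma>(2))
    finally have *: "n * s ^ 2 + u * s = n ^ 2 + \<gamma>" using n0 by simp
    show thesis
    proof
      show "n \<in> F - K" using nK nF by simp
      show "s \<in> F" using u \<sigma> nF by (simp add: s_def)
      have "u = n + \<gamma>" by (simp add: n_def add.assoc)
      then have "n * (n + s + s ^ 2) + \<gamma> * (1 + s) = (n * s ^ 2 + u * s) + (n ^ 2 + \<gamma>)"
        by (simp add: algebra_simps power2_eq_square del: add_eq_0)
      also have "\<dots> = 0" using * by simp
      finally show "n * (n + s + s ^ 2) = \<gamma> * (1 + s)" by simp
      show "s \<noteq> 0"
      proof
        assume "s = 0"
        with * have "\<gamma> = n ^ 2" by simp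
        then have "n = \<gamma> + (n ^ 2 + n)" by simp
        with True nF have "n \<in> K" by (metis K_I K_add)
        with nK show False ..
      qed
    qed
  qed
qed

text \<open>A \<open>w\<close> of trace 1 and norm \<open>n\<close> realises the normalised
  parameters: \<open>w\<close> and \<open>w + s\<close> collide.\<close>

lemma not_inj_f:
  assumes "\<gamma> \<in> F" "\<gamma> \<noteq> 0" "\<gamma> \<noteq> 1"
  shows "\<not> inj (f \<gamma>)"
proof -
  obtain n s where ns: "n \<in> F - K" "s \<in> F" "s \<noteq> 0" "n * (n + s + s ^ 2) = \<gamma> * (1 + s)"
    using assms by (rule collision_parameters)
  obtain w where w: "w ^ 2 + w = n" "w ^ q = w + 1" using ns(1) by (rule artin_schreier_root)
  have Tw: "T w = 1" by (simp add: T_def w)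
  have Nw: "N w = n" by (simp add: N_def w(2) power2_eq_square algebra_simps flip: w(1))
  define n' where "n' = n + s + s ^ 2"
  have "n' \<noteq> 0"
  proof
    assume "n' = 0"
    then have "n = s ^ 2 + s" by (simp add: n'_def add_ac)
    with ns show False by blast
  qed
  have n0: "n \<noteq> 0" using ns by auto
  \<comment> \<open>Multiply the collision equation by \<open>s\<close> and use
    \<open>n + n' = s * (1 + s)\<close>.\<close>
  have "s * (n * n') = \<gamma> * (n + n')" using ns(4) by (simp add: n'_def algebra_simps power2_eq_square)
  then have s: "s = \<gamma> * (1 / n + 1 / n')" using n0 \<open>n' \<noteq> 0\<close> by (simp add: field_simps)
  have "f \<gamma> (w + s) = w + s + \<gamma> * (1 + 1 / n')"
    using ns by (simp add: f_def T_add N_add Tw Nw n'_def)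
  also have "\<dots> = w + \<gamma> * (1 + 1 / n)" by (subst s) (simp add: algebra_simps)
  also have "\<dots> = f \<gamma> w" by (simp add: f_def Tw Nw)
  finally show ?thesis using ns(3) injD[of "f \<gamma>" "w + s" w] by auto
qed

lemma inj_f_iff: "\<gamma> \<in> F \<Longrightarrow> inj (f \<gamma>) \<longleftrightarrow> \<gamma> \<in> {0, 1}"
proof -
  assume "\<gamma> \<in> F"
  moreover have "inj (f 0)" by (simp add: f_def inj_def)
  ultimately show ?thesis using inj_f_1 not_inj_f by auto
qed

section \<open>Transfer to the polynomial and the given subfield\<close>

lemma f_eq_rel_trace:
  "f \<gamma> x = x + \<gamma> * rel_trace q (x + x ^ 2 + x ^ (2 * q - 1))"
proof (cases "x = 0")
  case True
  then show ?thesis using q_gt_1 by (simp add: f_def T_def rel_trace_def power_0_left)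
next
  case False
  define y where "y = x ^ q"
  have y0: "y \<noteq> 0" using False by (simp add: y_def)
  have yq: "y ^ q = x" by (simp add: y_def)
  have "x * x ^ (2 * q - 1) = x ^ (2 * q)"
    using q_gt_1 by (simp flip: power_Suc)
  also have "\<dots> = y ^ 2" by (simp add: y_def mult.commute flip: power_mult)
  finally have e: "x ^ (2 * q - 1) = y ^ 2 / x" using False by (simp add: field_simps)
  have sq: "(z ^ 2) ^ q = (z ^ q) ^ 2" for z :: 'a by (simp add: mult.commute flip: power_mult)
  have "rel_trace q (x + x ^ 2 + x ^ (2 * q - 1))
      = (x + x ^ 2 + y ^ 2 / x) + (y + y ^ 2 + x ^ 2 / y)"
    unfolding rel_trace_def e by (simp add: power_q_add power_divide sq yq flip: y_def)
  \<comment> \<open>In characteristic 2, \<open>(x + y)^3 = x^3 + y^3 + x y (x + y)\<close>, so the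
    cubic quotient absorbs the linear term \<open>x + y\<close>.\<close>
  also have "\<dots> = (x + y) ^ 2 + (x + y) ^ 3 / (x * y)"
    using False y0 by (simp add: divide_simps) (simp add: algebra_simps power2_eq_square power3_eq_cube)
  finally show ?thesis by (simp add: f_def T_def N_def y_def)
qed

end

text \<open>\<open>Fq\<close> consists of roots of \<open>X^q - X\<close>, which has at most
  \<open>q\<close> roots, so cardinality forces equality.\<close>

lemma quadratic_extension_char2I:
  fixes Fq :: "'a::{field,finite} set"
  assumes "q = 2 ^ m" "m > 0" "CARD('a) = q ^ 2"
    and sub: "subfield Fq (ring_of_type_algebra :: 'a ring)" and "card Fq = q"
  shows "quadratic_extension_char2 m q Fq"
proof
  show "Fq = {x. x ^ q = x}"
  proof (rule card_subset_eq)
    have "q > 1" unfolding assms(1) using assms(2) by (intro one_less_power) simp_all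
    note subringE = subringE[OF subfieldE(1)[OF sub]]
    have "x * y \<in> Fq" if "x \<in> Fq" "y \<in> Fq" for x y
      using subringE(6)[OF that] by (simp_all add: ring_of_type_algebra_def)
    moreover have "0 \<in> Fq"
      using subringE(2) by (simp add: ring_of_type_algebra_def)
    ultimately show sub': "Fq \<subseteq> {x. x ^ q = x}"
      using power_card_eq_self[of Fq] assms(5) by auto
    define p :: "'a poly" where "p = monom 1 q - monom 1 1"
    have "coeff p q \<noteq> 0" using \<open>q > 1\<close> by (simp add: p_def)
    then have "p \<noteq> 0" by auto
    moreover have "degree p \<le> q"
      unfolding p_def using \<open>q > 1\<close>
      by (intro degree_diff_le) (auto intro: order.trans[OF degree_monom_le])
    ultimately have "card {x. poly p x = 0} \<le> q"
      using card_poly_roots_bound[of p] by simp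
    then have "card {x :: 'a. x ^ q = x} \<le> q" by (simp add: p_def poly_monom)
    moreover have "card Fq \<le> card {x :: 'a. x ^ q = x}" using sub' by (simp add: card_mono)
    ultimately show "card Fq = card {x :: 'a. x ^ q = x}" using assms(5) by simp
  qed simp
qed (fact assms)+

theorem theorem3p2:
  fixes m q :: nat
    and Fq :: "'a::{field,finite} set"
    and \<gamma> :: 'a
    and x f :: "'a poly"
  assumes "odd m" and "q = 2 ^ m"
    and "CARD('a) = q ^ 2"
    and "subfield Fq (ring_of_type_algebra :: 'a ring)" and "card Fq = q"
    and "\<gamma> \<in> Fq"
  defines "x \<equiv> [:0, 1:]"
  defines "f \<equiv> x + [:\<gamma>:] * rel_trace q (x + x ^ 2 + x ^ (2 * q - 1))"
  shows "permutation_polynomial f \<longleftrightarrow> \<gamma> \<in> {0, 1}"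
proof -
  interpret E: quadratic_extension_char2 m q Fq
    using assms(2) odd_pos[OF assms(1)] assms(3-5) by (rule quadratic_extension_char2I)
  have "poly f = E.f \<gamma>"
    by (rule ext) (simp add: f_def x_def poly_rel_trace E.f_eq_rel_trace)
  moreover have "bij (E.f \<gamma>) \<longleftrightarrow> inj (E.f \<gamma>)"
    by (auto simp: bij_def finite_UNIV_inj_surj)
  ultimately show ?thesis
    using E.inj_f_iff[OF assms(6)] by (simp add: permutation_polynomial_def)
qed

end
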